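(* Let $x_1, \ldots, x_n \in \mathbb{R}^d$ be discrete probability distributions over a domain of $d$ elements with all coordinates strictly positive. Let $f$ be either $f(x,y) = \frac{D_{\mathrm{KL}}(x\,\|\,y) + D_{\mathrm{KL}}(y\,\|\,x)}{2}$ or the cross entropy $f(x,y) = H(x,y) = -\sum_{k=1}^d x(k)\log y(k)$, and let $A$ be the $n \times n$ matrix with $A_{i,j} = f(x_i,x_j)$. Then for any query $y \in \mathbb{R}^n$, $Ay$ can be computed exactly in $O(nd)$ time.
   Context: $D_{\mathrm{KL}}(x \,\|\, y) = \sum_{k=1}^d x(k)\log x(k) - x(k) \log y(k)$, where $x(k)$ denotes the $k$th coordinate of $x$. (The paper calls the first function the Jensen-Shannon divergence.) *)

theory Defs
  imports Complex_Main "Jordan_Normal_Form.Matrix"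
begin

section \<open>Distributions and divergences\<close>

definition pos_distribution :: "nat \<Rightarrow> real vec \<Rightarrow> bool" where
  "pos_distribution d p \<longleftrightarrow>
     p \<in> carrier_vec d \<and> (\<forall>k<d. 0 < p $ k) \<and> (\<Sum>k<d. p $ k) = 1"

definition KL_div :: "real vec \<Rightarrow> real vec \<Rightarrow> real" where
  "KL_div x y = (\<Sum>k<dim_vec x. x $ k * ln (x $ k) - x $ k * ln (y $ k))"

text \<open>The symmetrised divergence below, also known as the (halved) Jeffreys divergence, is what is
  called Jensen-Shannon divergence here; there is no mixture \<open>(x + y) / 2\<close> inside.\<close>

definition JS_div :: "real vec \<Rightarrow> real vec \<Rightarrow> real" where
  "JS_div x y = (KL_div x y + KL_div y x) / 2"

definition cross_entropy :: "real vec \<Rightarrow> real vec \<Rightarrow> real" where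
  "cross_entropy x y = - (\<Sum>k<dim_vec x. x $ k * ln (y $ k))"

definition pairwise_mat :: "(real vec \<Rightarrow> real vec \<Rightarrow> real) \<Rightarrow> nat \<Rightarrow> (nat \<Rightarrow> real vec) \<Rightarrow> real mat" where
  "pairwise_mat f n x = mat n n (\<lambda>(i, j). f (x i) (x j))"


section \<open>A unit-cost real RAM\<close>

text \<open>
  Exact real computation is measured on a real RAM: reals are held exactly, and each arithmetic
  operation, logarithm, comparison and memory access takes one time unit. There are three kinds of
  storage: natural-number registers (loop counters and addresses), real registers, and real arrays
  addressed by natural-number registers. A program is a fixed finite term, so it mentions finitely
  many registers and arrays, whatever the input size.

  The instruction set is deliberately weak, so that unit cost cannot be abused: index registers only
  have constants, addition and truncated subtraction (no multiplication), real constants are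
  integers, and reals are never converted to indices.
\<close>

type_synonym vname = string

record state =
  nreg :: "vname \<Rightarrow> nat"
  rreg :: "vname \<Rightarrow> real"
  arr :: "vname \<Rightarrow> nat \<Rightarrow> real"

datatype rop = Plus | Minus | Times | Divide

datatype test = NLess vname vname | RLess vname vname

datatype com =
    Skip
  | NConst vname nat
  | NAdd vname vname vname
  | NSub vname vname vname
  | RConst vname int
  | ROp rop vname vname vname
  | RLn vname vname
  | Load vname vname vname
  | Store vname vname vname
  | Seq com com
  | Cond test com com
  | While test com

fun test_holds :: "test \<Rightarrow> state \<Rightarrow> bool" where
  "test_holds (NLess i j) s = (nreg s i < nreg s j)"
| "test_holds (RLess u v) s = (rreg s u < rreg s v)"

text \<open>Operations are undefined outside their mathematical domain, rather than
  returning the default values of HOL; a run that attempts such an operation gets stuck.\<close>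

fun rop_val :: "rop \<Rightarrow> real \<Rightarrow> real \<Rightarrow> real option" where
  "rop_val Plus a b = Some (a + b)"
| "rop_val Minus a b = Some (a - b)"
| "rop_val Times a b = Some (a * b)"
| "rop_val Divide a b = (if b = 0 then None else Some (a / b))"

definition set_nreg :: "vname \<Rightarrow> nat \<Rightarrow> state \<Rightarrow> state" where
  "set_nreg i m s = s\<lparr>nreg := (nreg s)(i := m)\<rparr>"

definition set_rreg :: "vname \<Rightarrow> real \<Rightarrow> state \<Rightarrow> state" where
  "set_rreg u r s = s\<lparr>rreg := (rreg s)(u := r)\<rparr>"

definition set_arr :: "vname \<Rightarrow> nat \<Rightarrow> real \<Rightarrow> state \<Rightarrow> state" where
  "set_arr a m r s = s\<lparr>arr := (arr s)(a := (arr s a)(m := r))\<rparr>"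

text \<open>\<open>exec c s t s'\<close>: started in \<open>s\<close>, the program \<open>c\<close> terminates in \<open>s'\<close> after exactly \<open>t\<close> steps.\<close>

inductive exec :: "com \<Rightarrow> state \<Rightarrow> nat \<Rightarrow> state \<Rightarrow> bool" where
  Skip: "exec Skip s 1 s"
| NConst: "exec (NConst i m) s 1 (set_nreg i m s)"
| NAdd: "exec (NAdd i j k) s 1 (set_nreg i (nreg s j + nreg s k) s)"
| NSub: "exec (NSub i j k) s 1 (set_nreg i (nreg s j - nreg s k) s)"
| RConst: "exec (RConst u z) s 1 (set_rreg u (of_int z) s)"
| ROp: "rop_val p (rreg s v) (rreg s w) = Some r \<Longrightarrow> exec (ROp p u v w) s 1 (set_rreg u r s)"
| RLn: "0 < rreg s v \<Longrightarrow> exec (RLn u v) s 1 (set_rreg u (ln (rreg s v)) s)"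
| Load: "exec (Load u a i) s 1 (set_rreg u (arr s a (nreg s i)) s)"
| Store: "exec (Store a i u) s 1 (set_arr a (nreg s i) (rreg s u) s)"
| Seq: "exec c\<^sub>1 s t\<^sub>1 s' \<Longrightarrow> exec c\<^sub>2 s' t\<^sub>2 s'' \<Longrightarrow> exec (Seq c\<^sub>1 c\<^sub>2) s (t\<^sub>1 + t\<^sub>2) s''"
| CondTrue: "test_holds b s \<Longrightarrow> exec c\<^sub>1 s t s' \<Longrightarrow> exec (Cond b c\<^sub>1 c\<^sub>2) s (1 + t) s'"
| CondFalse: "\<not> test_holds b s \<Longrightarrow> exec c\<^sub>2 s t s' \<Longrightarrow> exec (Cond b c\<^sub>1 c\<^sub>2) s (1 + t) s'"
| WhileFalse: "\<not> test_holds b s \<Longrightarrow> exec (While b c) s 1 s"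
| WhileTrue: "test_holds b s \<Longrightarrow> exec c s t\<^sub>1 s' \<Longrightarrow> exec (While b c) s' t\<^sub>2 s'' \<Longrightarrow>
    exec (While b c) s (1 + t\<^sub>1 + t\<^sub>2) s''"

inductive_cases exec_elims:
  "exec Skip s t s'"
  "exec (NConst i m) s t s'"
  "exec (NAdd i j k) s t s'"
  "exec (NSub i j k) s t s'"
  "exec (RConst u z) s t s'"
  "exec (ROp p u v w) s t s'"
  "exec (RLn u v) s t s'"
  "exec (Load u a i) s t s'"
  "exec (Store a i u) s t s'"
  "exec (Seq c\<^sub>1 c\<^sub>2) s t s'"
  "exec (Cond b c\<^sub>1 c\<^sub>2) s t s'"
  "exec (While b c) s t s'"

text \<open>Runs are deterministic, so the existence of a run with some final state and
  running time describes the only terminating run.\<close>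

lemma exec_deterministic:
  "exec c s t s' \<Longrightarrow> exec c s u s'' \<Longrightarrow> t = u \<and> s' = s''"
proof (induction arbitrary: u s'' rule: exec.induct)
  case (Seq c1 s t1 s' c2 t2 s2)
  from Seq.prems obtain u1 u2 r where "exec c1 s u1 r" "exec c2 r u2 s''" "u = u1 + u2"
    by (rule exec_elims(10)) blast
  with Seq.IH show ?case by metis
next
  case (CondTrue b s c1 t s' c2)
  from CondTrue.prems obtain u' where "exec c1 s u' s''" "u = 1 + u'"
    by (rule exec_elims(11)) (use CondTrue.hyps in auto)
  with CondTrue.IH show ?case by metis
next
  case (CondFalse b s c2 t s' c1)
  from CondFalse.prems obtain u' where "exec c2 s u' s''" "u = 1 + u'"
    by (rule exec_elims(11)) (use CondFalse.hyps in auto)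
  with CondFalse.IH show ?case by metis
next
  case (WhileFalse b s c)
  from WhileFalse.prems show ?case
    by (rule exec_elims(12)) (use WhileFalse.hyps in auto)
next
  case (WhileTrue b s c t1 s' t2 s2)
  from WhileTrue.prems obtain u1 u2 r
    where "exec c s u1 r" "exec (While b c) r u2 s''" "u = 1 + u1 + u2"
    by (rule exec_elims(12)) (use WhileTrue.hyps in auto)
  with WhileTrue.IH show ?case by metis
qed (erule exec_elims(1-9), simp_all)+

text \<open>Input convention: the sizes are in registers \<open>n\<close> and \<open>d\<close>, the points are stored row by
  row in the array \<open>x\<close>, the query vector in the array \<open>y\<close>; all other storage is zero. The
  result is read off from the array \<open>out\<close>. In particular the matrix itself is not part of the input.\<close>

definition input_state :: "nat \<Rightarrow> nat \<Rightarrow> (nat \<Rightarrow> real vec) \<Rightarrow> real vec \<Rightarrow> state" where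
  "input_state n d x y =
     \<lparr>nreg = (\<lambda>_. 0)(''n'' := n, ''d'' := d),
      rreg = (\<lambda>_. 0),
      arr = (\<lambda>_ _. 0)
        (''x'' := (\<lambda>m. if m < n * d then x (m div d) $ (m mod d) else 0),
         ''y'' := (\<lambda>j. if j < n then y $ j else 0))\<rparr>"

definition output_vec :: "nat \<Rightarrow> state \<Rightarrow> real vec" where
  "output_vec n s = vec n (arr s ''out'')"

end

theory Submission
  imports Defs
begin

text \<open>
  Both functions have the form
  \<open>f u v = (\<Sum>k. \<beta> (u k ln (u k) + v k ln (v k) - v k ln (u k)) - u k ln (v k)) / \<gamma>\<close>, with
  \<open>(\<beta>, \<gamma>) = (1, 2)\<close> for the symmetrised divergence and \<open>(0, 1)\<close> for the cross entropy. Every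
  summand is a sum of products of a function of \<open>u k\<close> and a function of \<open>v k\<close>. Summing over the
  points \<open>v = x j\<close> with weights \<open>y j\<close> therefore only needs, for each coordinate \<open>k\<close>, the four
  column sums of \<open>y j\<close>, \<open>y j x j k\<close>, \<open>y j ln (x j k)\<close> and \<open>y j x j k ln (x j k)\<close>. One sweep over the
  \<open>n d\<close> input entries computes these, and a second one accumulates the output.
\<close>

section \<open>Programs for the two sweeps over the points\<close>

text \<open>Registers \<open>i\<close>, \<open>k\<close>, \<open>p\<close> hold the row, the column and the address \<open>p = i d + k\<close> of an entry.\<close>

definition advance :: com where
  "advance =
     Seq (NAdd ''p'' ''p'' ''one'') (Seq (NAdd ''k'' ''k'' ''one'')
       (Cond (NLess ''k'' ''d'') Skip
         (Seq (NConst ''k'' 0) (NAdd ''i'' ''i'' ''one''))))"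

text \<open>Index registers cannot multiply, so a single loop carries the flat address along instead
  of computing \<open>i * d + k\<close>. \<open>NAdd\<close> takes only registers, hence
  \<open>one\<close>.\<close>

definition sweep :: "com \<Rightarrow> com" where
  "sweep B =
     Seq (NConst ''one'' 1) (Seq (NConst ''i'' 0) (Seq (NConst ''k'' 0) (Seq (NConst ''p'' 0)
       (While (NLess ''i'' ''n'') (Seq B advance)))))"

definition accumulate :: "vname \<Rightarrow> vname \<Rightarrow> vname \<Rightarrow> com" where
  "accumulate A i u = Seq (Load ''acc'' A i) (Seq (ROp Plus ''acc'' ''acc'' u) (Store A i ''acc''))"

text \<open>\<open>Y\<close> ends with the same total in every column; storing it per column lets
  all four sums be handled at the index \<open>k\<close>.\<close>

definition column_sums :: com where
  "column_sums =
     Seq (Load ''v'' ''x'' ''p'') (Seq (RLn ''l'' ''v'') (Seq (Load ''w'' ''y'' ''i'')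
     (Seq (accumulate ''Y'' ''k'' ''w'')
     (Seq (ROp Times ''t'' ''w'' ''v'') (Seq (accumulate ''M'' ''k'' ''t'')
     (Seq (ROp Times ''t'' ''w'' ''l'') (Seq (accumulate ''L'' ''k'' ''t'')
     (Seq (ROp Times ''t'' ''t'' ''v'') (accumulate ''S'' ''k'' ''t'')))))))))"

text \<open>Real constants are integers, so a factor 1/2 has to enter as a division by
  \<gamma>.\<close>

definition row_sums :: "int \<Rightarrow> int \<Rightarrow> com" where
  "row_sums \<beta> \<gamma> =
     Seq (Load ''v'' ''x'' ''p'') (Seq (RLn ''l'' ''v'')
     (Seq (Load ''a'' ''Y'' ''k'') (Seq (ROp Times ''t'' ''v'' ''l'') (Seq (ROp Times ''t'' ''t'' ''a'')
     (Seq (Load ''a'' ''S'' ''k'') (Seq (ROp Plus ''t'' ''t'' ''a'')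
     (Seq (Load ''a'' ''M'' ''k'') (Seq (ROp Times ''a'' ''a'' ''l'') (Seq (ROp Minus ''t'' ''t'' ''a'')
     (Seq (RConst ''a'' \<beta>) (Seq (ROp Times ''t'' ''a'' ''t'')
     (Seq (Load ''a'' ''L'' ''k'') (Seq (ROp Times ''a'' ''v'' ''a'') (Seq (ROp Minus ''t'' ''t'' ''a'')
     (Seq (RConst ''a'' \<gamma>) (Seq (ROp Divide ''t'' ''t'' ''a'')
     (accumulate ''out'' ''i'' ''t'')))))))))))))))))"

definition pairwise_program :: "int \<Rightarrow> int \<Rightarrow> com" where
  "pairwise_program \<beta> \<gamma> = Seq (sweep column_sums) (sweep (row_sums \<beta> \<gamma>))"

section \<open>Symbolic execution of single instructions\<close>

lemma nreg_set [simp]: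
  "nreg (set_nreg i m s) = (nreg s)(i := m)"
  "nreg (set_rreg u r s) = nreg s"
  "nreg (set_arr a q r s) = nreg s"
  by (simp_all add: set_nreg_def set_rreg_def set_arr_def)

lemma rreg_set [simp]:
  "rreg (set_nreg i m s) = rreg s"
  "rreg (set_rreg u r s) = (rreg s)(u := r)"
  "rreg (set_arr a q r s) = rreg s"
  by (simp_all add: set_nreg_def set_rreg_def set_arr_def)

lemma arr_set [simp]:
  "arr (set_nreg i m s) = arr s"
  "arr (set_rreg u r s) = arr s"
  "arr (set_arr a q r s) = (arr s)(a := (arr s a)(q := r))"
  by (simp_all add: set_nreg_def set_rreg_def set_arr_def)

lemma set_rreg_set_rreg [simp]: "set_rreg u r (set_rreg u r' s) = set_rreg u r s"
  by (simp add: set_rreg_def)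

text \<open>The stored values are isolated in equational premises, so that they can be simplified at every
  step of a symbolic execution; otherwise the states grow exponentially.\<close>

lemma exec_NAdd: "nreg s j + nreg s k = m \<Longrightarrow> exec (NAdd i j k) s 1 (set_nreg i m s)"
  using exec.NAdd by metis

lemma exec_Load: "arr s a (nreg s i) = r \<Longrightarrow> exec (Load u a i) s 1 (set_rreg u r s)"
  using exec.Load by metis

lemma exec_Store:
  "nreg s i = q \<Longrightarrow> rreg s u = r \<Longrightarrow> exec (Store a i u) s 1 (set_arr a q r s)"
  using exec.Store by metis

lemma exec_RLn: "0 < rreg s v \<Longrightarrow> ln (rreg s v) = r \<Longrightarrow> exec (RLn u v) s 1 (set_rreg u r s)"
  using exec.RLn by metis

text \<open>\<open>Load\<close> overwrites \<open>acc\<close> before the addition reads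
  \<open>u\<close>, so \<open>u\<close> must be another register.\<close>

lemma exec_accumulate:
  assumes "u \<noteq> ''acc''" "nreg s i = q" "arr s A q + rreg s u = r"
  shows "exec (accumulate A i u) s 3 (set_arr A q r (set_rreg ''acc'' r s))"
proof -
  have "exec (accumulate A i u) s (1 + (1 + 1)) (set_arr A q r (set_rreg ''acc'' r s))"
    \<comment> \<open>Read backwards, the equation reinserts the intermediate write of the loaded
      value to \<open>acc\<close>, which gives the final state the form that the three rules
      produce.\<close>
    unfolding accumulate_def set_rreg_set_rreg[of _ r "arr s A q" s, symmetric]
    by (rule exec.Seq exec_Load exec.ROp exec_Store | simp add: assms)+
  then show ?thesis by (simp add: numeral_3_eq_3)
qed

lemmas exec_steps = exec.Seq exec.Skip exec.NConst exec_NAdd exec.RConst exec.ROp exec_RLn exec_Load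
  exec_accumulate

section \<open>Traversal of all entries by one loop\<close>

text \<open>Induction on the number \<open>n * d - m\<close> of entries left. \<open>Inv\<close>
  sees only the arrays, so the body may use real registers as scratch space. A round costs
  \<open>c\<close>, one test and at most 5 for \<open>advance\<close>; the final 1 is the failing
  test.\<close>

lemma sweep_loop:
  fixes Inv :: "nat \<Rightarrow> (vname \<Rightarrow> nat \<Rightarrow> real) \<Rightarrow> bool"
  assumes d: "0 < d"
    and body: "\<And>m s. \<lbrakk>m < n * d; Inv m (arr s); nreg s ''p'' = m; nreg s ''i'' = m div d;
        nreg s ''k'' = m mod d\<rbrakk>
      \<Longrightarrow> \<exists>s'. exec B s c s' \<and> nreg s' = nreg s \<and> Inv (Suc m) (arr s')"
    and "m \<le> n * d" "Inv m (arr s)"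
    and "nreg s ''p'' = m" "nreg s ''i'' = m div d" "nreg s ''k'' = m mod d"
    and "nreg s ''n'' = n" "nreg s ''d'' = d" "nreg s ''one'' = 1"
  shows "\<exists>t s'. exec (While (NLess ''i'' ''n'') (Seq B advance)) s t s'
     \<and> t \<le> (n * d - m) * (c + 6) + 1
     \<and> nreg s' ''n'' = n \<and> nreg s' ''d'' = d \<and> Inv (n * d) (arr s')"
    (is "\<exists>t s'. exec (While ?b (Seq B advance)) s t s' \<and> ?Q m t s'")
  using assms(3-)
proof (induction "n * d - m" arbitrary: m s)
  case 0
  then have m: "m = n * d" by simp
  \<comment> \<open>At \<open>m = n * d\<close> the row register holds
    \<open>n * d div d = n\<close>, so the test fails.\<close>
  have "exec (While ?b (Seq B advance)) s 1 s"
    by (rule exec.WhileFalse) (use 0 m d in simp)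
  then show ?case using 0 m by (intro exI[of _ 1] exI[of _ s]) simp
next
  case (Suc r)
  then have m: "m < n * d" by simp
  obtain s1 where s1: "exec B s c s1" "nreg s1 = nreg s" "Inv (Suc m) (arr s1)"
    using body[OF m] Suc.prems by blast
  have "\<exists>t s2. exec advance s1 t s2 \<and> t \<le> 5 \<and> arr s2 = arr s1
      \<and> nreg s2 ''p'' = Suc m \<and> nreg s2 ''i'' = Suc m div d \<and> nreg s2 ''k'' = Suc m mod d
      \<and> nreg s2 ''n'' = n \<and> nreg s2 ''d'' = d \<and> nreg s2 ''one'' = 1"
  \<comment> \<open>The next entry lies in the same row (4 steps) or opens a new one (5
    steps).\<close>
  proof (cases "Suc (m mod d) < d")
    case True
    then have next_index: "Suc m mod d = Suc (m mod d)" "Suc m div d = m div d"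
      by (simp_all add: mod_Suc div_Suc)
    have run: "exec advance s1 (1 + (1 + (1 + 1)))
        (set_nreg ''k'' (Suc (m mod d)) (set_nreg ''p'' (Suc m) s1))"
      unfolding advance_def by (rule exec_steps exec.CondTrue | use Suc.prems s1 True in simp)+
    show ?thesis
      by (rule exI, rule exI, rule conjI, rule run) (use Suc.prems s1 next_index in simp)
  next
    case False
    with d have "Suc (m mod d) = d" using mod_less_divisor[OF d, of m] by simp
    then have next_index: "Suc m mod d = 0" "Suc m div d = Suc (m div d)"
      by (simp_all add: mod_Suc div_Suc)
    have run: "exec advance s1 (1 + (1 + (1 + (1 + 1))))
        (set_nreg ''i'' (Suc (m div d)) (set_nreg ''k'' 0
          (set_nreg ''k'' (Suc (m mod d)) (set_nreg ''p'' (Suc m) s1))))"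
      unfolding advance_def by (rule exec_steps exec.CondFalse | use Suc.prems s1 False in simp)+
    show ?thesis
      by (rule exI, rule exI, rule conjI, rule run) (use Suc.prems s1 next_index in simp)
  qed
  then obtain t2 s2 where tail: "exec advance s1 t2 s2" "t2 \<le> 5"
    and s2: "arr s2 = arr s1"
      "nreg s2 ''p'' = Suc m" "nreg s2 ''i'' = Suc m div d" "nreg s2 ''k'' = Suc m mod d"
      "nreg s2 ''n'' = n" "nreg s2 ''d'' = d" "nreg s2 ''one'' = 1" by blast
  obtain t3 s3 where s3: "exec (While ?b (Seq B advance)) s2 t3 s3" "?Q (Suc m) t3 s3"
  proof -
    have "r = n * d - Suc m" using Suc.hyps(2) by simp
    then have "\<exists>t s'. exec (While ?b (Seq B advance)) s2 t s' \<and> ?Q (Suc m) t s'"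
      by (rule Suc.hyps(1)) (use m s1 s2 in simp_all)
    then show ?thesis using that by blast
  qed
  have "test_holds ?b s" using Suc.prems m d by (simp add: less_mult_imp_div_less)
  then have "exec (While ?b (Seq B advance)) s (1 + (c + t2) + t3) s3"
    using s1 tail s3 by (blast intro: exec.WhileTrue exec.Seq)
  moreover have "1 + (c + t2) + t3 \<le> (n * d - m) * (c + 6) + 1"
  proof -
    have "n * d - m = Suc (n * d - Suc m)" using m by simp
    then show ?thesis using tail s3 by simp
  qed
  ultimately show ?case using s3 by blast
qed

text \<open>The constant 5 is four initialisations plus the failing test.\<close>

lemma exec_sweep:
  fixes Inv :: "nat \<Rightarrow> (vname \<Rightarrow> nat \<Rightarrow> real) \<Rightarrow> bool"
  assumes d: "0 < d"
    and body: "\<And>m s. \<lbrakk>m < n * d; Inv m (arr s); nreg s ''p'' = m; nreg s ''i'' = m div d;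
        nreg s ''k'' = m mod d\<rbrakk>
      \<Longrightarrow> \<exists>s'. exec B s c s' \<and> nreg s' = nreg s \<and> Inv (Suc m) (arr s')"
    and s: "Inv 0 (arr s)" "nreg s ''n'' = n" "nreg s ''d'' = d"
  obtains t s' where "exec (sweep B) s t s'" "t \<le> n * d * (c + 6) + 5"
    "nreg s' ''n'' = n" "nreg s' ''d'' = d" "Inv (n * d) (arr s')"
proof -
  let ?s = "set_nreg ''p'' 0 (set_nreg ''k'' 0 (set_nreg ''i'' 0 (set_nreg ''one'' 1 s)))"
  have "\<exists>t s'. exec (While (NLess ''i'' ''n'') (Seq B advance)) ?s t s'
     \<and> t \<le> (n * d - 0) * (c + 6) + 1
     \<and> nreg s' ''n'' = n \<and> nreg s' ''d'' = d \<and> Inv (n * d) (arr s')"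
    using d body by (rule sweep_loop[where Inv = Inv]) (use s in simp_all)
  then obtain t s' where t: "exec (While (NLess ''i'' ''n'') (Seq B advance)) ?s t s'"
     "t \<le> n * d * (c + 6) + 1"
     "nreg s' ''n'' = n" "nreg s' ''d'' = d" "Inv (n * d) (arr s')"
    by auto
  have "exec (sweep B) s (1 + (1 + (1 + (1 + t)))) s'"
    unfolding sweep_def by (rule exec.Seq exec.NConst t(1))+
  with t show ?thesis by (intro that) auto
qed

section \<open>Sums over flat addresses\<close>

text \<open>The range splits into \<open>n\<close> blocks of length \<open>d\<close>; in block
  \<open>j\<close> the substitution \<open>m = k + j * d\<close> gives quotient \<open>j\<close> and
  remainder \<open>k\<close>.\<close>

lemma sum_div_mod:
  fixes h :: "nat \<Rightarrow> nat \<Rightarrow> 'a :: comm_monoid_add"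
  shows "(\<Sum>m<n * d. h (m div d) (m mod d)) = (\<Sum>j<n. \<Sum>k<d. h j k)"
proof -
  have "(\<Sum>m<n * d. h (m div d) (m mod d)) = (\<Sum>j<n. \<Sum>m=j * d..<j * d + d. h (m div d) (m mod d))"
    by (rule sum.nat_group[symmetric])
  also have "\<dots> = (\<Sum>j<n. \<Sum>k<d. h j k)"
  proof (rule sum.cong[OF refl])
    fix j
    have "(\<Sum>m=j * d..<j * d + d. h (m div d) (m mod d))
        = (\<Sum>k=0..<d. h ((k + j * d) div d) ((k + j * d) mod d))"
      using sum.shift_bounds_nat_ivl[of "\<lambda>m. h (m div d) (m mod d)" 0 "j * d" d]
      by (simp add: add.commute)
    also have "\<dots> = (\<Sum>k<d. h j k)"
      by (rule sum.cong) (auto simp: atLeast0LessThan)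
    finally show "(\<Sum>m=j * d..<j * d + d. h (m div d) (m mod d)) = (\<Sum>k<d. h j k)" .
  qed
  finally show ?thesis .
qed

lemma sum_column:
  fixes h :: "nat \<Rightarrow> nat \<Rightarrow> 'a :: comm_monoid_add"
  assumes "k < d"
  shows "(\<Sum>m<n * d. if m mod d = k then h (m div d) (m mod d) else 0) = (\<Sum>j<n. h j k)"
  using sum_div_mod[of "\<lambda>j l. if l = k then h j l else 0" d n] assms by simp

lemma sum_row:
  fixes h :: "nat \<Rightarrow> nat \<Rightarrow> 'a :: comm_monoid_add"
  assumes "i < n"
  shows "(\<Sum>m<n * d. if m div d = i then h (m div d) (m mod d) else 0) = (\<Sum>k<d. h i k)"
proof -
  \<comment> \<open>The row condition is constant in the inner sum; once it is moved outside, the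
    outer sum collapses to \<open>j = i\<close>.\<close>
  have "(\<Sum>k<d. if j = i then h j k else 0) = (if j = i then \<Sum>k<d. h j k else 0)" for j
    by simp
  then show ?thesis
    using sum_div_mod[of "\<lambda>j l. if j = i then h j l else 0" d n] assms by simp
qed

text \<open>Content of an accumulator array after the first \<open>m\<close> entries, for use in the
  loop invariants.\<close>

definition partial_column :: "nat \<Rightarrow> (nat \<Rightarrow> nat \<Rightarrow> real) \<Rightarrow> nat \<Rightarrow> nat \<Rightarrow> real" where
  "partial_column d h m k = (\<Sum>q<m. if q mod d = k then h (q div d) (q mod d) else 0)"

definition partial_row :: "nat \<Rightarrow> (nat \<Rightarrow> nat \<Rightarrow> real) \<Rightarrow> nat \<Rightarrow> nat \<Rightarrow> real" where
  "partial_row d h m i = (\<Sum>q<m. if q div d = i then h (q div d) (q mod d) else 0)"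

text \<open>Phrased as a function update to match the effect of \<open>Store\<close> on an
  array.\<close>

lemma partial_column_Suc:
  "partial_column d h (Suc m) = (partial_column d h m)
     (m mod d := partial_column d h m (m mod d) + h (m div d) (m mod d))"
  by (auto simp: partial_column_def fun_eq_iff)

lemma partial_row_Suc:
  "partial_row d h (Suc m) = (partial_row d h m)
     (m div d := partial_row d h m (m div d) + h (m div d) (m mod d))"
  by (auto simp: partial_row_def fun_eq_iff)

lemma partial_column_0: "partial_column d h 0 = (\<lambda>_. 0)"
  by (simp add: partial_column_def fun_eq_iff)

lemma partial_row_0: "partial_row d h 0 = (\<lambda>_. 0)"
  by (simp add: partial_row_def fun_eq_iff)

lemma partial_column_full:
  "k < d \<Longrightarrow> partial_column d h (n * d) k = (\<Sum>j<n. h j k)"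
  unfolding partial_column_def by (rule sum_column)

lemma partial_row_full:
  "i < n \<Longrightarrow> partial_row d h (n * d) i = (\<Sum>k<d. h i k)"
  unfolding partial_row_def by (rule sum_row)

section \<open>Effect and cost of the loop bodies and of the program\<close>

text \<open>Six single instructions and four accumulations of cost 3 give 18. Positivity keeps
  \<open>RLn\<close> from getting stuck.\<close>

lemma exec_column_sums:
  assumes "0 < arr s ''x'' (nreg s ''p'')"
  defines "v \<equiv> arr s ''x'' (nreg s ''p'')" and "w \<equiv> arr s ''y'' (nreg s ''i'')"
    and "k \<equiv> nreg s ''k''"
  shows "\<exists>s'. exec column_sums s 18 s' \<and> nreg s' = nreg s \<and>
    arr s' = (arr s)
      (''Y'' := (arr s ''Y'')(k := arr s ''Y'' k + w),
       ''M'' := (arr s ''M'')(k := arr s ''M'' k + w * v),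
       ''L'' := (arr s ''L'')(k := arr s ''L'' k + w * ln v),
       ''S'' := (arr s ''S'')(k := arr s ''S'' k + w * ln v * v))"
proof -
  \<comment> \<open>The time follows the nesting of \<open>Seq\<close>, so that the rules of
    \<open>exec\<close> unify with it; it is evaluated only at the end.\<close>
  have "\<exists>s'. exec column_sums s (1 + (1 + (1 + (3 + (1 + (3 + (1 + (3 + (1 + 3))))))))) s' \<and> nreg s' = nreg s \<and>
    arr s' = (arr s)
      (''Y'' := (arr s ''Y'')(k := arr s ''Y'' k + w),
       ''M'' := (arr s ''M'')(k := arr s ''M'' k + w * v),
       ''L'' := (arr s ''L'')(k := arr s ''L'' k + w * ln v),
       ''S'' := (arr s ''S'')(k := arr s ''S'' k + w * ln v * v))"
    unfolding column_sums_def
    by (intro exI conjI)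
      (rule exec_steps | use assms(1) in \<open>simp add: v_def w_def k_def\<close>)+
  then show ?thesis by simp
qed

lemma exec_row_sums:
  assumes "0 < arr s ''x'' (nreg s ''p'')" and "\<gamma> \<noteq> 0"
  defines "v \<equiv> arr s ''x'' (nreg s ''p'')" and "k \<equiv> nreg s ''k''" and "i \<equiv> nreg s ''i''"
  shows "\<exists>s'. exec (row_sums \<beta> \<gamma>) s 20 s' \<and> nreg s' = nreg s \<and>
    arr s' = (arr s)
      (''out'' := (arr s ''out'')(i := arr s ''out'' i +
         (\<beta> * (v * ln v * arr s ''Y'' k + arr s ''S'' k - arr s ''M'' k * ln v)
            - v * arr s ''L'' k) / \<gamma>))"
proof -
  have "\<exists>s'. exec (row_sums \<beta> \<gamma>) s (1 + (1 + (1 + (1 + (1 + (1 + (1 + (1 + (1 + (1 + (1 + (1 + (1 + (1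
       + (1 + (1 + (1 + 3))))))))))))))))) s' \<and> nreg s' = nreg s \<and>
    arr s' = (arr s)
      (''out'' := (arr s ''out'')(i := arr s ''out'' i +
         (\<beta> * (v * ln v * arr s ''Y'' k + arr s ''S'' k - arr s ''M'' k * ln v)
            - v * arr s ''L'' k) / \<gamma>))"
    unfolding row_sums_def
    by (intro exI conjI)
      (rule exec_steps | use assms(1,2) in \<open>simp add: v_def k_def i_def\<close>)+
  then show ?thesis by simp
qed

text \<open>The sweeps cost at most \<open>18 + 6\<close> and \<open>20 + 6\<close> per entry and 5
  more each, hence 50 and 10.\<close>

lemma exec_pairwise_program:
  fixes x :: "nat \<Rightarrow> real vec" and y :: "real vec" and \<beta> \<gamma> :: int
  assumes d: "0 < d" and \<gamma>: "\<gamma> \<noteq> 0"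
    and pos: "\<And>i k. \<lbrakk>i < n; k < d\<rbrakk> \<Longrightarrow> 0 < x i $ k"
  defines "weighted \<equiv> \<lambda>g k. \<Sum>j<n. y $ j * g (x j $ k)"
  obtains t s where "exec (pairwise_program \<beta> \<gamma>) (input_state n d x y) t s"
    "t \<le> 50 * (n * d) + 10"
    "\<And>i. i < n \<Longrightarrow> arr s ''out'' i =
       (\<Sum>k<d. (\<beta> * (x i $ k * ln (x i $ k) * weighted (\<lambda>_. 1) k + weighted (\<lambda>v. ln v * v) k
                    - weighted (\<lambda>v. v) k * ln (x i $ k))
                - x i $ k * weighted ln k) / \<gamma>)"
proof -
  let ?X = "\<lambda>m. if m < n * d then x (m div d) $ (m mod d) else 0"
  let ?Y = "\<lambda>j. if j < n then y $ j else 0"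
  let ?c = "\<lambda>g. partial_column d (\<lambda>j k. y $ j * g (x j $ k))"
  \<comment> \<open>\<open>out\<close> is kept at zero, so that the second sweep can start from an
    empty partial row sum.\<close>
  define Inv1 where "Inv1 = (\<lambda>m \<alpha>. \<alpha> ''x'' = ?X \<and> \<alpha> ''y'' = ?Y
    \<and> \<alpha> ''Y'' = ?c (\<lambda>_. 1) m \<and> \<alpha> ''M'' = ?c (\<lambda>v. v) m
    \<and> \<alpha> ''L'' = ?c ln m \<and> \<alpha> ''S'' = ?c (\<lambda>v. ln v * v) m \<and> \<alpha> ''out'' = (\<lambda>_. 0))"
  have div_mod: "m div d < n" "m mod d < d" if "m < n * d" for m
    using that d by (simp_all add: less_mult_imp_div_less)
  have body1: "\<exists>s'. exec column_sums s 18 s' \<and> nreg s' = nreg s \<and> Inv1 (Suc m) (arr s')"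
    if m: "m < n * d" and "Inv1 m (arr s)" "nreg s ''p'' = m" "nreg s ''i'' = m div d"
      "nreg s ''k'' = m mod d" for m s
    using exec_column_sums[of s] that pos[OF div_mod[OF m]] div_mod[OF m]
    by (auto simp: Inv1_def partial_column_Suc mult.assoc)
  obtain t1 s1 where s1: "exec (sweep column_sums) (input_state n d x y) t1 s1"
    "t1 \<le> n * d * (18 + 6) + 5" "nreg s1 ''n'' = n" "nreg s1 ''d'' = d" "Inv1 (n * d) (arr s1)"
    using d body1 by (rule exec_sweep[where Inv = Inv1 and s = "input_state n d x y"])
      (simp_all add: Inv1_def input_state_def partial_column_0)
  \<comment> \<open>The column sums are taken at \<open>n * d\<close>: they are complete, and the
    second sweep leaves them fixed.\<close>
  let ?h = "\<lambda>i k. (\<beta> * (x i $ k * ln (x i $ k) * ?c (\<lambda>_. 1) (n * d) k + ?c (\<lambda>v. ln v * v) (n * d) k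
                    - ?c (\<lambda>v. v) (n * d) k * ln (x i $ k))
                - x i $ k * ?c ln (n * d) k) / \<gamma>"
  define Inv2 where "Inv2 = (\<lambda>m \<alpha>. \<alpha> ''x'' = ?X
    \<and> \<alpha> ''Y'' = ?c (\<lambda>_. 1) (n * d) \<and> \<alpha> ''M'' = ?c (\<lambda>v. v) (n * d)
    \<and> \<alpha> ''L'' = ?c ln (n * d) \<and> \<alpha> ''S'' = ?c (\<lambda>v. ln v * v) (n * d)
    \<and> \<alpha> ''out'' = partial_row d ?h m)"
  have body2: "\<exists>s'. exec (row_sums \<beta> \<gamma>) s 20 s' \<and> nreg s' = nreg s \<and> Inv2 (Suc m) (arr s')"
    if m: "m < n * d" and "Inv2 m (arr s)" "nreg s ''p'' = m" "nreg s ''i'' = m div d"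
      "nreg s ''k'' = m mod d" for m s
    using exec_row_sums[of s \<gamma> \<beta>] \<gamma> that pos[OF div_mod[OF m]]
    by (auto simp: Inv2_def partial_row_Suc)
  obtain t2 s2 where s2: "exec (sweep (row_sums \<beta> \<gamma>)) s1 t2 s2"
    "t2 \<le> n * d * (20 + 6) + 5" "Inv2 (n * d) (arr s2)"
    using d body2 by (rule exec_sweep[where Inv = Inv2 and s = s1])
      (use s1 in \<open>simp_all add: Inv1_def Inv2_def partial_row_0\<close>)
  show ?thesis
  proof (rule that)
    show "exec (pairwise_program \<beta> \<gamma>) (input_state n d x y) (t1 + t2) s2"
      unfolding pairwise_program_def using s1 s2 by (blast intro: exec.Seq)
    show "t1 + t2 \<le> 50 * (n * d) + 10" using s1 s2 by simp
    fix i assume "i < n"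
    then show "arr s2 ''out'' i =
       (\<Sum>k<d. (\<beta> * (x i $ k * ln (x i $ k) * weighted (\<lambda>_. 1) k + weighted (\<lambda>v. ln v * v) k
                    - weighted (\<lambda>v. v) k * ln (x i $ k))
                - x i $ k * weighted ln k) / \<gamma>)"
      using s2 by (simp add: Inv2_def partial_row_full partial_column_full weighted_def)
  qed
qed

section \<open>The matrix-vector product\<close>

text \<open>After exchanging the sums over \<open>j\<close> and \<open>k\<close>, the factors that
  depend on \<open>x i\<close> alone leave the sum over \<open>j\<close>, and
  \<open>weighted\<close> sums remain.\<close>

lemma pairwise_program_correct:
  fixes f :: "real vec \<Rightarrow> real vec \<Rightarrow> real" and \<beta> \<gamma> :: int
  assumes \<gamma>: "\<gamma> \<noteq> 0"
    and f: "\<And>d u v. \<lbrakk>u \<in> carrier_vec d; v \<in> carrier_vec d\<rbrakk> \<Longrightarrow>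
      f u v = (\<Sum>k<d. (\<beta> * (u $ k * ln (u $ k) + v $ k * ln (v $ k) - v $ k * ln (u $ k))
                       - u $ k * ln (v $ k)) / \<gamma>)"
    and n: "1 \<le> n" and x: "\<forall>i<n. pos_distribution d (x i)" and y: "y \<in> carrier_vec n"
  shows "\<exists>t s. exec (pairwise_program \<beta> \<gamma>) (input_state n d x y) t s \<and> t \<le> 60 * (n * d) \<and>
    output_vec n s = pairwise_mat f n x *\<^sub>v y"
proof -
  \<comment> \<open>The coordinates of \<open>x 0\<close> sum to 1, whereas an empty sum would be
    0.\<close>
  have d: "0 < d"
    using x n by (cases d) (auto simp: pos_distribution_def)
  define weighted where "weighted = (\<lambda>g k. \<Sum>j<n. y $ j * g (x j $ k))"
  obtain t s where s: "exec (pairwise_program \<beta> \<gamma>) (input_state n d x y) t s"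
    "t \<le> 50 * (n * d) + 10"
    and out: "\<And>i. i < n \<Longrightarrow> arr s ''out'' i =
       (\<Sum>k<d. (\<beta> * (x i $ k * ln (x i $ k) * weighted (\<lambda>_. 1) k + weighted (\<lambda>v. ln v * v) k
                    - weighted (\<lambda>v. v) k * ln (x i $ k))
                - x i $ k * weighted ln k) / \<gamma>)"
    unfolding weighted_def
    by (rule exec_pairwise_program[where n = n and x = x and y = y and \<beta> = \<beta>, OF d \<gamma>]) (use x in \<open>auto simp: pos_distribution_def\<close>)
  \<comment> \<open>This lets \<open>10 * (n * d)\<close> absorb the additive 10.\<close>
  have "1 \<le> n * d" using n d by (simp add: Suc_le_eq)
  then have "t \<le> 60 * (n * d)" using s by linarith
  moreover have "output_vec n s = pairwise_mat f n x *\<^sub>v y"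
  proof (rule eq_vecI)
    fix i assume "i < dim_vec (pairwise_mat f n x *\<^sub>v y)"
    then have i: "i < n" by (simp add: pairwise_mat_def)
    have "(pairwise_mat f n x *\<^sub>v y) $ i = (\<Sum>j<n. f (x i) (x j) * y $ j)"
      using i y by (simp add: pairwise_mat_def scalar_prod_def atLeast0LessThan)
    also have "\<dots> = (\<Sum>j<n. \<Sum>k<d. (\<beta> * (x i $ k * ln (x i $ k) + x j $ k * ln (x j $ k)
        - x j $ k * ln (x i $ k)) - x i $ k * ln (x j $ k)) / \<gamma> * y $ j)"
      using x i by (intro sum.cong refl) (simp add: f[of _ d] pos_distribution_def sum_distrib_right)
    also have "\<dots> = (\<Sum>k<d. \<Sum>j<n. (\<beta> * (x i $ k * ln (x i $ k) + x j $ k * ln (x j $ k)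
        - x j $ k * ln (x i $ k)) - x i $ k * ln (x j $ k)) / \<gamma> * y $ j)"
      by (rule sum.swap)
    \<comment> \<open>The products are grouped to match the summands of \<open>weighted\<close>
      literally; \<open>y $ j * 1\<close> belongs to the constant function 1.\<close>
    also have "\<dots> = (\<Sum>k<d. \<Sum>j<n. (\<beta> * (x i $ k * ln (x i $ k) * (y $ j * 1)
        + y $ j * (ln (x j $ k) * x j $ k) - y $ j * x j $ k * ln (x i $ k))
        - x i $ k * (y $ j * ln (x j $ k))) / \<gamma>)"
      unfolding times_divide_eq_left
      by (intro sum.cong refl arg_cong[where f = "\<lambda>z. z / real_of_int \<gamma>"]) (simp add: algebra_simps)
    also have "\<dots> = arr s ''out'' i"
      unfolding out[OF i] weighted_def
      by (simp only: sum_divide_distrib[symmetric] sum_subtractf sum.distrib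
          sum_distrib_left[symmetric] sum_distrib_right[symmetric])
    finally show "output_vec n s $ i = (pairwise_mat f n x *\<^sub>v y) $ i"
      using i by (simp add: output_vec_def)
  qed (simp add: output_vec_def pairwise_mat_def)
  ultimately show ?thesis using s by blast
qed

theorem theorem20:
  fixes f :: "real vec \<Rightarrow> real vec \<Rightarrow> real"
  assumes "f = JS_div \<or> f = cross_entropy"
  shows "\<exists>(P :: com) (C :: nat). \<forall>(n :: nat) (d :: nat) (x :: nat \<Rightarrow> real vec) (y :: real vec).
           1 \<le> n \<longrightarrow> (\<forall>i<n. pos_distribution d (x i)) \<longrightarrow> y \<in> carrier_vec n \<longrightarrow>
           (\<exists>t s. exec P (input_state n d x y) t s \<and> t \<le> C * (n * d) \<and>
                  output_vec n s = pairwise_mat f n x *\<^sub>v y)"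
proof -
  \<comment> \<open>Both integers are chosen before \<open>d\<close>, so one program and one
    constant serve all sizes.\<close>
  obtain \<beta> \<gamma> :: int where \<gamma>: "\<gamma> \<noteq> 0"
    and f: "\<And>d u v. \<lbrakk>u \<in> carrier_vec d; v \<in> carrier_vec d\<rbrakk> \<Longrightarrow>
      f u v = (\<Sum>k<d. (\<beta> * (u $ k * ln (u $ k) + v $ k * ln (v $ k) - v $ k * ln (u $ k))
                       - u $ k * ln (v $ k)) / \<gamma>)"
    using assms
  proof
    assume "f = JS_div"
    then show ?thesis
      by (intro that[where \<beta> = 1 and \<gamma> = 2])
        (auto simp: JS_div_def KL_div_def sum.distrib[symmetric] sum_divide_distrib algebra_simps)
  next
    assume "f = cross_entropy"
    then show ?thesis
      by (intro that[where \<beta> = 0 and \<gamma> = 1]) (auto simp: cross_entropy_def sum_negf)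
  qed
  show ?thesis
  proof (rule exI[of _ "pairwise_program \<beta> \<gamma>"], rule exI[of _ 60], intro allI impI)
    fix n d :: nat and x :: "nat \<Rightarrow> real vec" and y :: "real vec"
    assume "1 \<le> n" "\<forall>i<n. pos_distribution d (x i)" "y \<in> carrier_vec n"
    with \<gamma> f show "\<exists>t s. exec (pairwise_program \<beta> \<gamma>) (input_state n d x y) t s \<and> t \<le> 60 * (n * d)
        \<and> output_vec n s = pairwise_mat f n x *\<^sub>v y"
      by (rule pairwise_program_correct)
  qed
qed

end
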